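(* Let $T$ be a ternary $\Gamma$-semiring, and for an ideal $I$ of $T$ put $V(I):=\{\mathfrak{p}\in\mathrm{Spec}(T)\mid I\subseteq\mathfrak{p}\}$. Then the family $\{V(I)\mid I\text{ an ideal of }T\}$ is the collection of closed sets of a topology on $\mathrm{Spec}(T)$.
   Context: Fix a commutative monoid $(\Gamma,+,0_\Gamma)$. A ternary $\Gamma$-semiring is a commutative monoid $(T,+,0)$ with a map $T\times\Gamma\times T\times\Gamma\times T\to T$, $(a,\alpha,b,\beta,c)\mapsto a\alpha b\beta c$, that is additive in each of the five slots separately, satisfies ternary associativity $(a\alpha b\beta c)\gamma d\delta e=a\alpha(b\beta c\gamma d)\delta e=a\alpha b\beta(c\gamma d\delta e)$ for all $a,b,c,d,e\in T$, $\alpha,\beta,\gamma,\delta\in\Gamma$, and satisfies $a\alpha b\beta c=0$ whenever one of $a,b,c$ is $0$ or one of $\alpha,\beta$ is $0_\Gamma$. An ideal of $T$ is a subset $I\subseteq T$ that is a submonoid of $(T,+,0)$ and such that for all $x\in I$, $a,b\in T$, $\alpha,\beta\in\Gamma$ one has $a\alpha b\beta x\in I$, $a\alpha x\beta b\in I$ and $x\alpha a\beta b\in I$. For $S\subseteq T$, $\langle S\rangle$ denotes the smallest ideal containing $S$. For ideals $I,J$ define $I\cdot J:=\langle\{i\alpha t\beta j\mid i\in I,\ t\in T,\ j\in J,\ \alpha,\beta\in\Gamma\}\rangle$. A proper ideal $\mathfrak{p}\subsetneq T$ is prime if for all ideals $I,J\subseteq T$, $I\cdot J\subseteq\mathfrak{p}$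 implies $I\subseteq\mathfrak{p}$ or $J\subseteq\mathfrak{p}$. $\mathrm{Spec}(T)$ is the set of all prime ideals of $T$. *)

theory Defs
  imports "HOL-Analysis.Abstract_Topology"
begin

text \<open>The monoids \<open>\<Gamma>\<close> and \<open>T\<close> are types \<open>'g\<close> and \<open>'t\<close> of class \<open>comm_monoid_add\<close>;
  \<open>tp a \<alpha> b \<beta> c\<close> stands for the product \<open>a\<alpha>b\<beta>c\<close>.\<close>

locale ternary_gamma_semiring =
  fixes tp :: "'t::comm_monoid_add \<Rightarrow> 'g::comm_monoid_add \<Rightarrow> 't \<Rightarrow> 'g \<Rightarrow> 't \<Rightarrow> 't"
  assumes add_1: "tp (a + a') \<alpha> b \<beta> c = tp a \<alpha> b \<beta> c + tp a' \<alpha> b \<beta> c"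
    and add_2: "tp a (\<alpha> + \<alpha>') b \<beta> c = tp a \<alpha> b \<beta> c + tp a \<alpha>' b \<beta> c"
    and add_3: "tp a \<alpha> (b + b') \<beta> c = tp a \<alpha> b \<beta> c + tp a \<alpha> b' \<beta> c"
    and add_4: "tp a \<alpha> b (\<beta> + \<beta>') c = tp a \<alpha> b \<beta> c + tp a \<alpha> b \<beta>' c"
    and add_5: "tp a \<alpha> b \<beta> (c + c') = tp a \<alpha> b \<beta> c + tp a \<alpha> b \<beta> c'"
    and assoc_left: "tp (tp a \<alpha> b \<beta> c) \<gamma> d \<delta> e = tp a \<alpha> (tp b \<beta> c \<gamma> d) \<delta> e"
    and assoc_right: "tp a \<alpha> (tp b \<beta> c \<gamma> d) \<delta> e = tp a \<alpha> b \<beta> (tp c \<gamma> d \<delta> e)"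
    and zero_1: "tp 0 \<alpha> b \<beta> c = 0"
    and zero_2: "tp a 0 b \<beta> c = 0"
    and zero_3: "tp a \<alpha> 0 \<beta> c = 0"
    and zero_4: "tp a \<alpha> b 0 c = 0"
    and zero_5: "tp a \<alpha> b \<beta> 0 = 0"

definition tgs_ideal ::
  "('t::comm_monoid_add \<Rightarrow> 'g::comm_monoid_add \<Rightarrow> 't \<Rightarrow> 'g \<Rightarrow> 't \<Rightarrow> 't) \<Rightarrow> 't set \<Rightarrow> bool" where
  "tgs_ideal tp I \<longleftrightarrow>
     0 \<in> I \<and> (\<forall>x\<in>I. \<forall>y\<in>I. x + y \<in> I) \<and>
     (\<forall>x\<in>I. \<forall>a b \<alpha> \<beta>. tp a \<alpha> b \<beta> x \<in> I \<and> tp a \<alpha> x \<beta> b \<in> I \<and> tp x \<alpha> a \<beta> b \<in> I)"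

definition ideal_gen ::
  "('t::comm_monoid_add \<Rightarrow> 'g::comm_monoid_add \<Rightarrow> 't \<Rightarrow> 'g \<Rightarrow> 't \<Rightarrow> 't) \<Rightarrow> 't set \<Rightarrow> 't set" where
  "ideal_gen tp S = tgs_ideal tp hull S"

lemma tgs_ideal_ideal_gen: "tgs_ideal tp (ideal_gen tp S)"
  unfolding ideal_gen_def by (rule hull_in) (simp add: tgs_ideal_def)

lemma subset_ideal_gen: "S \<subseteq> ideal_gen tp S"
  unfolding ideal_gen_def by (rule hull_subset)

lemma ideal_gen_least: "S \<subseteq> I \<Longrightarrow> tgs_ideal tp I \<Longrightarrow> ideal_gen tp S \<subseteq> I"
  unfolding ideal_gen_def by (rule hull_minimal)

definition ideal_mult ::
  "('t::comm_monoid_add \<Rightarrow> 'g::comm_monoid_add \<Rightarrow> 't \<Rightarrow> 'g \<Rightarrow> 't \<Rightarrow> 't)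
     \<Rightarrow> 't set \<Rightarrow> 't set \<Rightarrow> 't set" where
  "ideal_mult tp I J = ideal_gen tp {tp i \<alpha> t \<beta> j | i \<alpha> t \<beta> j. i \<in> I \<and> j \<in> J}"

definition tgs_prime ::
  "('t::comm_monoid_add \<Rightarrow> 'g::comm_monoid_add \<Rightarrow> 't \<Rightarrow> 'g \<Rightarrow> 't \<Rightarrow> 't) \<Rightarrow> 't set \<Rightarrow> bool" where
  "tgs_prime tp P \<longleftrightarrow> tgs_ideal tp P \<and> P \<noteq> UNIV \<and>
     (\<forall>I J. tgs_ideal tp I \<longrightarrow> tgs_ideal tp J \<longrightarrow> ideal_mult tp I J \<subseteq> P \<longrightarrow> I \<subseteq> P \<or> J \<subseteq> P)"

definition Spec ::
  "('t::comm_monoid_add \<Rightarrow> 'g::comm_monoid_add \<Rightarrow> 't \<Rightarrow> 'g \<Rightarrow> 't \<Rightarrow> 't) \<Rightarrow> 't set set" where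
  "Spec tp = {P. tgs_prime tp P}"

definition V ::
  "('t::comm_monoid_add \<Rightarrow> 'g::comm_monoid_add \<Rightarrow> 't \<Rightarrow> 'g \<Rightarrow> 't \<Rightarrow> 't)
     \<Rightarrow> 't set \<Rightarrow> 't set set" where
  "V tp I = {P \<in> Spec tp. I \<subseteq> P}"

end

theory Submission
  imports Defs
begin

text \<open>Finite unions and arbitrary intersections of the sets \<open>V tp I\<close> are again of
  this form. For two ideals, I \<cdot> J lies in I \<inter> J, so a prime containing I \<inter> J
  contains I or J; this gives \<open>V_Un\<close>. For a family, a prime is itself an ideal, so it
  contains every member iff it contains the ideal generated by their union
  (\<open>V_ideal_gen\<close>). The empty family yields the whole spectrum, and properness of primes
  makes \<open>V tp UNIV\<close> empty (\<open>V_UNIV\<close>).\<close>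

lemma tgs_ideal_Int:
  assumes "tgs_ideal tp I" "tgs_ideal tp J"
  shows "tgs_ideal tp (I \<inter> J)"
  using assms by (simp add: tgs_ideal_def)

text \<open>In a generator, i fills the first slot and j the last, so both ideals absorb the
  product.\<close>

lemma ideal_mult_subset_Int:
  assumes "tgs_ideal tp I" "tgs_ideal tp J"
  shows "ideal_mult tp I J \<subseteq> I \<inter> J"
  unfolding ideal_mult_def
proof (rule ideal_gen_least)
  show "{tp i \<alpha> t \<beta> j | i \<alpha> t \<beta> j. i \<in> I \<and> j \<in> J} \<subseteq> I \<inter> J"
    using assms by (auto simp: tgs_ideal_def)
  show "tgs_ideal tp (I \<inter> J)"
    using assms by (rule tgs_ideal_Int)
qed

lemma V_Un:
  assumes "tgs_ideal tp I" "tgs_ideal tp J"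
  shows "V tp I \<union> V tp J = V tp (I \<inter> J)"
proof -
  have "I \<subseteq> P \<or> J \<subseteq> P" if "tgs_prime tp P" "I \<inter> J \<subseteq> P" for P
    using that assms ideal_mult_subset_Int[OF assms] unfolding tgs_prime_def by (meson subset_trans)
  then show ?thesis
    by (auto simp: V_def Spec_def)
qed

lemma V_ideal_gen: "V tp (ideal_gen tp S) = {P \<in> Spec tp. S \<subseteq> P}"
proof -
  have "ideal_gen tp S \<subseteq> P \<longleftrightarrow> S \<subseteq> P" if "P \<in> Spec tp" for P
    using that ideal_gen_least[of S P tp] subset_ideal_gen[of S tp]
    by (auto simp: Spec_def tgs_prime_def)
  then show ?thesis
    by (auto simp: V_def)
qed

lemma V_UNIV: "V tp UNIV = {}"
  by (auto simp: V_def Spec_def tgs_prime_def)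

text \<open>Phrased with complements because \<open>topology\<close> takes open sets.
  \<open>istopology\<close> asks only for binary intersections and arbitrary unions; the empty union
  supplies the empty set, while openness of \<open>Spec tp\<close> is left to the final
  proof.\<close>

lemma istopology_zariski:
  "istopology (\<lambda>U. \<exists>I. tgs_ideal tp I \<and> U = Spec tp - V tp I)"
  (is "istopology ?open")
  unfolding istopology_def
proof (intro conjI allI impI)
  fix A B
  assume "?open A" "?open B"
  then obtain I J where "tgs_ideal tp I" "A = Spec tp - V tp I"
    "tgs_ideal tp J" "B = Spec tp - V tp J"
    by blast
  then have "A \<inter> B = Spec tp - V tp (I \<inter> J)" "tgs_ideal tp (I \<inter> J)"
    by (simp_all add: Diff_Un tgs_ideal_Int flip: V_Un)
  then show "?open (A \<inter> B)"
    by blast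
next
  fix \<U>
  assume *: "\<forall>U\<in>\<U>. ?open U"
  \<comment> \<open>Taking every ideal that represents a member of \<U> avoids choosing one ideal
    per member.\<close>
  define \<I> where "\<I> = {I. tgs_ideal tp I \<and> Spec tp - V tp I \<in> \<U>}"
  have "\<U> = (\<lambda>I. Spec tp - V tp I) ` \<I>"
    using * by (fastforce simp: \<I>_def)
  then have "\<Union>\<U> = Spec tp - V tp (ideal_gen tp (\<Union>\<I>))"
    unfolding V_ideal_gen by (auto simp: V_def)
  then show "?open (\<Union>\<U>)"
    using tgs_ideal_ideal_gen by blast
qed

theorem theorem12p7:
  fixes tp :: "'t::comm_monoid_add \<Rightarrow> 'g::comm_monoid_add \<Rightarrow> 't \<Rightarrow> 'g \<Rightarrow> 't \<Rightarrow> 't"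
  assumes "ternary_gamma_semiring tp"
  shows "\<exists>X :: 't set topology.
           topspace X = Spec tp \<and> {C. closedin X C} = {V tp I | I. tgs_ideal tp I}"
proof (intro exI conjI)
  define X where "X = topology (\<lambda>U. \<exists>I. tgs_ideal tp I \<and> U = Spec tp - V tp I)"
  have openin_X: "openin X U \<longleftrightarrow> (\<exists>I. tgs_ideal tp I \<and> U = Spec tp - V tp I)" for U
    unfolding X_def by (simp add: topology_inverse'[OF istopology_zariski])
  \<comment> \<open>\<open>topspace\<close> is the union of all open sets, so it equals
    \<open>Spec tp\<close> once \<open>Spec tp\<close> itself is open, as the complement of
    \<open>V tp UNIV\<close>.\<close>
  have "tgs_ideal tp UNIV"
    by (simp add: tgs_ideal_def)
  then have "openin X (Spec tp)"
    unfolding openin_X using V_UNIV[of tp] by (metis Diff_empty)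
  moreover have "topspace X \<subseteq> Spec tp"
    using openin_X[of "topspace X"] by auto
  ultimately show topspace_X: "topspace X = Spec tp"
    by (simp add: openin_subset subset_antisym)
  have V_compl: "Spec tp - (Spec tp - V tp I) = V tp I" for I
    by (auto simp: V_def)
  have "closedin X C \<longleftrightarrow> (\<exists>I. tgs_ideal tp I \<and> C = V tp I)" for C
  proof
    assume "closedin X C"
    then obtain I where "C \<subseteq> Spec tp" "tgs_ideal tp I" "Spec tp - C = Spec tp - V tp I"
      unfolding closedin_def topspace_X openin_X by blast
    \<comment> \<open>C and \<open>V tp I\<close> both lie in \<open>Spec tp\<close> and have the
      same complement there, hence coincide.\<close>
    then show "\<exists>I. tgs_ideal tp I \<and> C = V tp I"
      using V_compl[of I] by (metis double_diff subset_refl)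
  next
    assume "\<exists>I. tgs_ideal tp I \<and> C = V tp I"
    then show "closedin X C"
      unfolding closedin_def topspace_X openin_X by (auto simp: V_def)
  qed
  then show "{C. closedin X C} = {V tp I | I. tgs_ideal tp I}"
    by auto
qed

end
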